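(* Let $k$ be an ordered field equipped with the identity conjugation. For each nonnegative integer $i$ choose a negative $D_i\in k$, and recursively define the $k$-algebras $k^i$, $i\ge 0$, by $k^0=k$ and $k^i=k^{i-1}\times^{D_i}k^{i-1}$ for $i\ge 1$. Then every $k^i$, $i\ge 0$, has multiplicative norm, that is, $n(ab)=n(a)n(b)$ for all $a,b\in k^i$.
   Context: Let $k$ be a field. A $k$-algebra $K$ (not assumed commutative, associative or distributive) is a left $k$-vector space equipped with a multiplication and a multiplicative identity $1$ such that: $k$ is a subset of the center of $K$, and the additive and multiplicative structure on $k$ is the restriction of that on $K$; and $a(bc)=(ab)c$ for $a,b,c\in K$ whenever at least one of $a,b,c$ belongs to $k$. A conjugation on $K$ is a self-inverse $k$-linear map $\overline{\phantom{a}}:K\to K$ restricting to the identity on $k$. The norm is $n(a)=\overline{a}a$. $K$ is a division algebra over $k$ if for each nonzero $a\in K$ there is a unique $b\in K$ with $ab=ba=1$; then $b$ is written $a^{-1}$. Given a $k$-algebra $K$ with conjugation which is a division algebra, and $D\in k$, the Conway-Smith double $K\times^D K$ is the $k$-vector space $K\times K$ with conjugation $\overline{(a,b)}=(\overline{a},-b)$ and multiplication, for $a,b,c,d\in K$, $$(a,b)(c,d)=\left(ac+D\,\overline{b\,\overline{d}}\,,\ \overline{\overline{b}\;\overline{c}}+\overline{\overline{b}\;\overline{\overline{a}\;\overline{\overline{b^{-1}}\;\overline{d}}}}\right)\quad\text{if } b\ne 0,$$ and $(a,b)(c,d)=(ac,\overline{a}d)$ if $b=0$. It is a $k$-algebra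 with identity $(1,0)$; $K$ (and hence $k$) is regarded as contained in it via $a\mapsto(a,0)$. In the situation of the claim each $k^i$ is a division algebra with $a^{-1}=\overline{a}\,n(a)^{-1}$, so the recursion makes sense. $k$ is ordered if it carries a total order $\le$ such that $a\le b$ implies $a+c\le b+c$, and $0\le a$, $0\le b$ imply $0\le ab$. An element is negative if it is $\le 0$ and nonzero. *)

theory Defs
  imports "HOL-Algebra.Module"
begin

text \<open>
  A \<open>k\<close>-algebra with conjugation is represented by the signature of a module (which
  already contains the ring operations), extended by the conjugation. No associativity,
  commutativity or distributivity is built into this record. The library operations
  \<open>inv\<close> and \<open>\<ominus>\<close> only assert being the unique two-sided inverse inside the carrier, so
  \<open>inv\<close> is also the inverse of a non-associative division algebra.
\<close>

record ('k, 'v) conj_algebra = "('k, 'v) module" +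
  conjugate :: "'v \<Rightarrow> 'v" (\<open>cjg\<index> _\<close> [81] 80)

definition alg_norm :: "('k, 'v, 'm) conj_algebra_scheme \<Rightarrow> 'v \<Rightarrow> 'v"
  where "alg_norm K a = cjg\<^bsub>K\<^esub> a \<otimes>\<^bsub>K\<^esub> a"

definition multiplicative_norm :: "('k, 'v, 'm) conj_algebra_scheme \<Rightarrow> bool"
  where "multiplicative_norm K \<longleftrightarrow>
    (\<forall>a \<in> carrier K. \<forall>b \<in> carrier K.
       alg_norm K (a \<otimes>\<^bsub>K\<^esub> b) = alg_norm K a \<otimes>\<^bsub>K\<^esub> alg_norm K b)"

text \<open>
  The underlying set of the \<open>i\<close>-th algebra of the tower is the \<open>i\<close>-fold iterated square
  of \<open>k\<close>, so its HOL type would depend on \<open>i\<close>. All these sets are placed in one type of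
  formal nested pairs: \<open>Double a b\<close> stands for the pair \<open>(a, b)\<close>. The carrier of each
  algebra selects the relevant elements; the operations are unspecified on values that
  are not of the shape of carrier elements.
\<close>

datatype 'k nested = Base 'k | Double "'k nested" "'k nested"

definition base_algebra :: "('k::field, 'k nested) conj_algebra"
  where "base_algebra =
    \<lparr> carrier = range Base,
      mult = (\<lambda>x y. case (x, y) of (Base a, Base b) \<Rightarrow> Base (a * b) | _ \<Rightarrow> undefined),
      one = Base 1,
      zero = Base 0,
      add = (\<lambda>x y. case (x, y) of (Base a, Base b) \<Rightarrow> Base (a + b) | _ \<Rightarrow> undefined),
      smult = (\<lambda>s x. case x of Base a \<Rightarrow> Base (s * a) | _ \<Rightarrow> undefined),
      conjugate = (\<lambda>x. x) \<rparr>"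

context
  fixes K :: "('k, 'v) conj_algebra" (structure)
begin

definition cs_mult :: "'k \<Rightarrow> 'v \<times> 'v \<Rightarrow> 'v \<times> 'v \<Rightarrow> 'v \<times> 'v"
  where "cs_mult D = (\<lambda>(a, b) (c, d).
    if b = \<zero> then (a \<otimes> c, cjg a \<otimes> d)
    else (a \<otimes> c \<oplus> D \<odot> cjg (b \<otimes> cjg d),
          cjg (cjg b \<otimes> cjg c)
            \<oplus> cjg (cjg b \<otimes> cjg (cjg a \<otimes> cjg (cjg (inv b) \<otimes> cjg d)))))"

end

context
  fixes K :: "('k, 'k nested) conj_algebra" (structure)
begin

definition cs_double :: "'k \<Rightarrow> ('k, 'k nested) conj_algebra"
  where "cs_double D =
    \<lparr> carrier = {Double a b | a b. a \<in> carrier K \<and> b \<in> carrier K},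
      mult = (\<lambda>x y. case (x, y) of
          (Double a b, Double c d) \<Rightarrow> case_prod Double (cs_mult K D (a, b) (c, d))
        | _ \<Rightarrow> undefined),
      one = Double \<one> \<zero>,
      zero = Double \<zero> \<zero>,
      add = (\<lambda>x y. case (x, y) of
          (Double a b, Double c d) \<Rightarrow> Double (a \<oplus> c) (b \<oplus> d)
        | _ \<Rightarrow> undefined),
      smult = (\<lambda>s x. case x of Double a b \<Rightarrow> Double (s \<odot> a) (s \<odot> b) | _ \<Rightarrow> undefined),
      conjugate = (\<lambda>x. case x of Double a b \<Rightarrow> Double (cjg a) (\<ominus> b) | _ \<Rightarrow> undefined) \<rparr>"

end

primrec cs_tower :: "(nat \<Rightarrow> 'k::field) \<Rightarrow> nat \<Rightarrow> ('k, 'k nested) conj_algebra"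
  where
    "cs_tower D 0 = base_algebra"
  | "cs_tower D (Suc i) = cs_double (cs_tower D i) (D (Suc i))"

end

theory Submission
  imports Defs
begin

text \<open>
  Each algebra of the tower carries a positive definite symmetric bilinear form \<open>B\<close>, which on
  a double is \<open>B (a, b) (c, d) = B a c - D * B b d\<close>. Conjugation is self-adjoint for \<open>B\<close>, the
  adjoint of left multiplication by \<open>a\<close> is left multiplication by its conjugate, and left
  multiplication by \<open>a\<close> scales \<open>B\<close> by \<open>B a a\<close>. These properties pass to the double: the two
  cross terms in the norm of a product cancel by adjointness. They give
  \<open>n a = B a a\<close>, and the scaling property is then the multiplicativity of the norm.
\<close>

text \<open>
  Since \<open>B\<close> is nondegenerate, the vector space laws, the linearity of conjugation and the
  linearity of left multiplications all follow from these axioms, by testing against \<open>B\<close>.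
\<close>

locale composition_algebra =
  fixes K :: "('k::linordered_field, 'v) conj_algebra" (structure)
    and B :: "'v \<Rightarrow> 'v \<Rightarrow> 'k"
  assumes zero_closed [simp]: "\<zero> \<in> carrier K"
    and one_closed [simp]: "\<one> \<in> carrier K"
    and add_closed [simp]: "\<lbrakk>x \<in> carrier K; y \<in> carrier K\<rbrakk> \<Longrightarrow> x \<oplus> y \<in> carrier K"
    and smult_closed [simp]: "x \<in> carrier K \<Longrightarrow> s \<odot> x \<in> carrier K"
    and cjg_closed [simp]: "x \<in> carrier K \<Longrightarrow> cjg x \<in> carrier K"
    and mult_closed [simp]: "\<lbrakk>x \<in> carrier K; y \<in> carrier K\<rbrakk> \<Longrightarrow> x \<otimes> y \<in> carrier K"
    and form_commute: "\<lbrakk>x \<in> carrier K; y \<in> carrier K\<rbrakk> \<Longrightarrow> B x y = B y x"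
    and form_zero_left [simp]: "x \<in> carrier K \<Longrightarrow> B \<zero> x = 0"
    and form_add_left [simp]:
      "\<lbrakk>x \<in> carrier K; y \<in> carrier K; z \<in> carrier K\<rbrakk> \<Longrightarrow> B (x \<oplus> y) z = B x z + B y z"
    and form_smult_left [simp]:
      "\<lbrakk>x \<in> carrier K; z \<in> carrier K\<rbrakk> \<Longrightarrow> B (s \<odot> x) z = s * B x z"
    and form_ext:
      "\<lbrakk>x \<in> carrier K; y \<in> carrier K; \<And>z. z \<in> carrier K \<Longrightarrow> B x z = B y z\<rbrakk> \<Longrightarrow> x = y"
    and form_pos: "\<lbrakk>x \<in> carrier K; x \<noteq> \<zero>\<rbrakk> \<Longrightarrow> 0 < B x x"
    and cjg_cjg [simp]: "x \<in> carrier K \<Longrightarrow> cjg (cjg x) = x"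
    and cjg_one [simp]: "cjg \<one> = \<one>"
    and form_cjg: "\<lbrakk>x \<in> carrier K; y \<in> carrier K\<rbrakk> \<Longrightarrow> B (cjg x) y = B x (cjg y)"
    and mult_one [simp]: "x \<in> carrier K \<Longrightarrow> x \<otimes> \<one> = x"
    \<comment> \<open>The other axioms on the product keep the left factor fixed, up to conjugation.
      Homogeneity in that factor is therefore required separately; additivity is not.\<close>
    and smult_mult:
      "\<lbrakk>x \<in> carrier K; y \<in> carrier K\<rbrakk> \<Longrightarrow> (s \<odot> x) \<otimes> y = s \<odot> (x \<otimes> y)"
    and form_adjoint:
      "\<lbrakk>a \<in> carrier K; x \<in> carrier K; y \<in> carrier K\<rbrakk> \<Longrightarrow> B (a \<otimes> x) y = B x (cjg a \<otimes> y)"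
    and form_scale:
      "\<lbrakk>a \<in> carrier K; x \<in> carrier K; y \<in> carrier K\<rbrakk>
        \<Longrightarrow> B (a \<otimes> x) (a \<otimes> y) = B a a * B x y"
begin

section \<open>Linear algebra derived from the form\<close>

lemma form_zero_right [simp]: "x \<in> carrier K \<Longrightarrow> B x \<zero> = 0"
  using form_commute[of x \<zero>] by simp

lemma form_add_right [simp]:
  "\<lbrakk>x \<in> carrier K; y \<in> carrier K; z \<in> carrier K\<rbrakk> \<Longrightarrow> B z (x \<oplus> y) = B z x + B z y"
  by (simp add: form_commute[of z])

lemma form_smult_right [simp]:
  "\<lbrakk>x \<in> carrier K; z \<in> carrier K\<rbrakk> \<Longrightarrow> B z (s \<odot> x) = s * B z x"
  by (simp add: form_commute[of z])

lemma form_cjg_cjg [simp]: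
  "\<lbrakk>x \<in> carrier K; y \<in> carrier K\<rbrakk> \<Longrightarrow> B (cjg x) (cjg y) = B x y"
  by (simp add: form_cjg)

lemma add_zero [simp]: "x \<in> carrier K \<Longrightarrow> x \<oplus> \<zero> = x"
  by (rule form_ext) auto

lemma smult_one [simp]: "x \<in> carrier K \<Longrightarrow> 1 \<odot> x = x"
  by (rule form_ext) auto

lemma zero_smult [simp]: "x \<in> carrier K \<Longrightarrow> 0 \<odot> x = \<zero>"
  by (rule form_ext) auto

lemma smult_zero [simp]: "s \<odot> \<zero> = \<zero>"
  by (rule form_ext) auto

lemma smult_smult [simp]: "x \<in> carrier K \<Longrightarrow> s \<odot> (t \<odot> x) = (s * t) \<odot> x"
  by (rule form_ext) auto

lemma smult_eq_zero_iff [simp]: "x \<in> carrier K \<Longrightarrow> s \<odot> x = \<zero> \<longleftrightarrow> s = 0 \<or> x = \<zero>"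
proof
  assume x: "x \<in> carrier K" and "s \<odot> x = \<zero>"
  then have "s * B x x = 0"
    using form_smult_left[of x x s] by simp
  then show "s = 0 \<or> x = \<zero>"
    using form_pos[OF x] by auto
qed auto

lemma cjg_smult [simp]: "x \<in> carrier K \<Longrightarrow> cjg (s \<odot> x) = s \<odot> cjg x"
  by (rule form_ext) (auto simp: form_cjg)

lemma cjg_zero [simp]: "cjg \<zero> = \<zero>"
  by (rule form_ext) (auto simp: form_cjg)

text \<open>A map that has an adjoint for a nondegenerate form is linear.\<close>

lemma mult_smult:
  "\<lbrakk>x \<in> carrier K; y \<in> carrier K\<rbrakk> \<Longrightarrow> x \<otimes> (s \<odot> y) = s \<odot> (x \<otimes> y)"
  by (rule form_ext) (auto simp: form_adjoint)

lemma mult_zero [simp]: "x \<in> carrier K \<Longrightarrow> x \<otimes> \<zero> = \<zero>"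
  by (rule form_ext) (auto simp: form_adjoint)

lemma zero_mult [simp]: "x \<in> carrier K \<Longrightarrow> \<zero> \<otimes> x = \<zero>"
  using smult_mult[of \<zero> x 0] by simp

text \<open>Needed because conjugation on a double is written with \<open>\<ominus>\<close>. That
  operation is a definite description, so uniqueness must be shown too; testing against
  \<open>B\<close> reduces it to uniqueness of negatives in the field.\<close>

lemma a_inv_eq_smult: "x \<in> carrier K \<Longrightarrow> \<ominus> x = (-1) \<odot> x"
  unfolding a_inv_def m_inv_def
proof (rule the_equality)
  assume x: "x \<in> carrier K"
  then have "x \<oplus> (-1) \<odot> x = \<zero>" "(-1) \<odot> x \<oplus> x = \<zero>"
    by (auto intro!: form_ext)
  with x show "(-1) \<odot> x \<in> carrier (add_monoid K)
      \<and> x \<otimes>\<^bsub>add_monoid K\<^esub> ((-1) \<odot> x) = \<one>\<^bsub>add_monoid K\<^esub>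
      \<and> ((-1) \<odot> x) \<otimes>\<^bsub>add_monoid K\<^esub> x = \<one>\<^bsub>add_monoid K\<^esub>"
    by simp
next
  fix y
  assume x: "x \<in> carrier K" and "y \<in> carrier (add_monoid K)
      \<and> x \<otimes>\<^bsub>add_monoid K\<^esub> y = \<one>\<^bsub>add_monoid K\<^esub> \<and> y \<otimes>\<^bsub>add_monoid K\<^esub> x = \<one>\<^bsub>add_monoid K\<^esub>"
  then have y: "y \<in> carrier K" and sum: "x \<oplus> y = \<zero>"
    by auto
  show "y = (-1) \<odot> x"
  proof (rule form_ext)
    fix z
    assume z: "z \<in> carrier K"
    with x y have "B x z + B y z = 0"
      using form_add_left[of x y z] by (simp add: sum)
    with x z show "B y z = B ((-1) \<odot> x) z"
      by (simp add: eq_neg_iff_add_eq_0 add.commute)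
  qed (use x y in auto)
qed

section \<open>Norms, inverses and the doubled product\<close>

text \<open>Pairing with \<open>z\<close> and moving \<open>cjg a\<close> across gives
  \<open>B (a \<otimes> x) (a \<otimes> z)\<close>, which the scaling axiom evaluates. This law
  stands in for associativity below.\<close>

lemma cjg_mult_mult:
  "\<lbrakk>a \<in> carrier K; x \<in> carrier K\<rbrakk> \<Longrightarrow> cjg a \<otimes> (a \<otimes> x) = B a a \<odot> x"
  by (rule form_ext) (auto simp: form_adjoint[of "cjg a"] form_scale)

lemma cjg_mult_self: "a \<in> carrier K \<Longrightarrow> cjg a \<otimes> a = B a a \<odot> \<one>"
  using cjg_mult_mult[of a \<one>] by simp

lemma mult_cjg_self: "a \<in> carrier K \<Longrightarrow> a \<otimes> cjg a = B a a \<odot> \<one>"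
  using cjg_mult_self[of "cjg a"] by simp

lemma m_inv_eq:
  assumes b: "b \<in> carrier K" "b \<noteq> \<zero>"
  shows "inv b = inverse (B b b) \<odot> cjg b"
  unfolding m_inv_def
proof (rule the_equality)
  have "B b b \<noteq> 0"
    using form_pos[OF b] by simp
  with b show "inverse (B b b) \<odot> cjg b \<in> carrier K
      \<and> b \<otimes> (inverse (B b b) \<odot> cjg b) = \<one> \<and> (inverse (B b b) \<odot> cjg b) \<otimes> b = \<one>"
    by (simp add: mult_smult smult_mult mult_cjg_self cjg_mult_self)
next
  fix y
  assume y: "y \<in> carrier K \<and> b \<otimes> y = \<one> \<and> y \<otimes> b = \<one>"
  have "B b b \<noteq> 0"
    using form_pos[OF b] by simp
  \<comment> \<open>Multiply \<open>b \<otimes> y = \<one>\<close> by \<open>cjg b\<close> on the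
    left; no associativity is available, but \<open>cjg_mult_mult\<close> collapses the left
    side.\<close>
  moreover have "B b b \<odot> y = cjg b"
    using cjg_mult_mult[of b y] y b by simp
  ultimately show "y = inverse (B b b) \<odot> cjg b"
    using smult_smult[of y "inverse (B b b)" "B b b"] y by simp
qed

lemma multiplicative_norm: "multiplicative_norm K"
  unfolding multiplicative_norm_def alg_norm_def
  by (simp add: cjg_mult_self form_scale smult_mult mult_smult mult.commute)

lemma cs_mult_zero:
  "cs_mult K D (a, \<zero>) (c, d) = (a \<otimes> c, cjg a \<otimes> d)"
  by (simp add: cs_mult_def)

text \<open>As \<open>inv b\<close> is a scalar times \<open>cjg b\<close>, the scalar moves to the
  front and the innermost factor becomes \<open>cjg (b \<otimes> cjg d)\<close>, the same element as
  in the first coordinate. This makes the cross terms of the norm comparable.\<close>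

lemma cs_mult_nonzero:
  assumes "a \<in> carrier K" "b \<in> carrier K" "d \<in> carrier K" "b \<noteq> \<zero>"
  shows "cs_mult K D (a, b) (c, d) =
    (a \<otimes> c \<oplus> D \<odot> cjg (b \<otimes> cjg d),
     cjg (cjg b \<otimes> cjg c)
       \<oplus> inverse (B b b) \<odot> cjg (cjg b \<otimes> cjg (cjg a \<otimes> cjg (b \<otimes> cjg d))))"
  using assms by (simp add: cs_mult_def m_inv_eq smult_mult mult_smult)

end

section \<open>The form and the operations on a double\<close>

definition double_form ::
    "('k nested \<Rightarrow> 'k nested \<Rightarrow> 'k) \<Rightarrow> 'k::field \<Rightarrow> 'k nested \<Rightarrow> 'k nested \<Rightarrow> 'k"
  where "double_form B D x y = (case (x, y) of
    (Double a b, Double c d) \<Rightarrow> B a c - D * B b d | _ \<Rightarrow> undefined)"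

lemma double_form_Double [simp]:
  "double_form B D (Double a b) (Double c d) = B a c - D * B b d"
  by (simp add: double_form_def)

lemma cs_double_simps [simp]:
  "Double a b \<in> carrier (cs_double K D) \<longleftrightarrow> a \<in> carrier K \<and> b \<in> carrier K"
  "one (cs_double K D) = Double \<one>\<^bsub>K\<^esub> \<zero>\<^bsub>K\<^esub>"
  "zero (cs_double K D) = Double \<zero>\<^bsub>K\<^esub> \<zero>\<^bsub>K\<^esub>"
  "Double a b \<oplus>\<^bsub>cs_double K D\<^esub> Double c d = Double (a \<oplus>\<^bsub>K\<^esub> c) (b \<oplus>\<^bsub>K\<^esub> d)"
  "s \<odot>\<^bsub>cs_double K D\<^esub> Double a b = Double (s \<odot>\<^bsub>K\<^esub> a) (s \<odot>\<^bsub>K\<^esub> b)"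
  "cjg\<^bsub>cs_double K D\<^esub> Double a b = Double (cjg\<^bsub>K\<^esub> a) (\<ominus>\<^bsub>K\<^esub> b)"
  "Double a b \<otimes>\<^bsub>cs_double K D\<^esub> Double c d = case_prod Double (cs_mult K D (a, b) (c, d))"
  by (simp_all add: cs_double_def)

lemma cs_double_carrierE:
  assumes "x \<in> carrier (cs_double K D)"
  obtains a b where "x = Double a b" "a \<in> carrier K" "b \<in> carrier K"
  using assms by (auto simp: cs_double_def)

section \<open>Doubling preserves the axioms\<close>

context
  fixes K :: "('k::linordered_field, 'k nested) conj_algebra" (structure)
    and B :: "'k nested \<Rightarrow> 'k nested \<Rightarrow> 'k"
    and D :: 'k
  assumes K: "composition_algebra K B" and D: "D < 0"
begin

interpretation composition_algebra K B
  by (rule K)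

lemma double_smult_mult:
  assumes "a \<in> carrier K" "b \<in> carrier K" "c \<in> carrier K" "d \<in> carrier K"
  shows "(s \<odot>\<^bsub>cs_double K D\<^esub> Double a b) \<otimes>\<^bsub>cs_double K D\<^esub> Double c d =
    s \<odot>\<^bsub>cs_double K D\<^esub> (Double a b \<otimes>\<^bsub>cs_double K D\<^esub> Double c d)"
\<comment> \<open>Exactly in this case \<open>s \<odot> b\<close> is zero, so that the scaled factor
  falls under the other clause of the product.\<close>
proof (cases "s = 0 \<or> b = \<zero>")
  case True
  with assms show ?thesis
    by (cases "b = \<zero>") (auto simp: cs_mult_zero cs_mult_nonzero smult_mult)
next
  case False
  \<comment> \<open>In the last summand \<open>b\<close> occurs twice and \<open>a\<close> once,
    giving \<open>s^3\<close>, while \<open>inverse (B b b)\<close> contributes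
    \<open>s^(-2)\<close>.\<close>
  with assms show ?thesis
    by (auto simp: cs_mult_nonzero smult_mult mult_smult field_simps intro!: form_ext)
qed

lemma double_form_adjoint:
  assumes "a \<in> carrier K" "b \<in> carrier K" "c \<in> carrier K" "d \<in> carrier K"
    "e \<in> carrier K" "f \<in> carrier K"
  shows "double_form B D (Double a b \<otimes>\<^bsub>cs_double K D\<^esub> Double c d) (Double e f) =
    double_form B D (Double c d)
      (cjg\<^bsub>cs_double K D\<^esub> Double a b \<otimes>\<^bsub>cs_double K D\<^esub> Double e f)"
proof (cases "b = \<zero>")
  case True
  with assms show ?thesis
    by (simp add: a_inv_eq_smult cs_mult_zero form_adjoint)
next
  case False
  \<comment> \<open>The two terms of degree one in \<open>b\<close> swap coordinates, their change
    of sign matching the weight \<open>- D\<close> of the second one. In the term with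
    \<open>inverse (B b b)\<close>, moving the factors across reverses the word \<open>b\<close>,
    \<open>a\<close>, \<open>b\<close>: it keeps its shape with \<open>a\<close> conjugated, and the
    two signs of \<open>b\<close> cancel.\<close>
  with assms show ?thesis
    by (simp add: a_inv_eq_smult cs_mult_nonzero smult_mult mult_smult form_adjoint form_cjg
        algebra_simps)
qed

lemma double_form_scale:
  assumes "a \<in> carrier K" "b \<in> carrier K" "c \<in> carrier K" "d \<in> carrier K"
    "e \<in> carrier K" "f \<in> carrier K"
  shows "double_form B D (Double a b \<otimes>\<^bsub>cs_double K D\<^esub> Double c d)
      (Double a b \<otimes>\<^bsub>cs_double K D\<^esub> Double e f) =
    double_form B D (Double a b) (Double a b) * double_form B D (Double c d) (Double e f)"
proof (cases "b = \<zero>")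
  case True
  with assms show ?thesis
    by (simp add: cs_mult_zero form_scale algebra_simps)
next
  case False
  then have nz: "B b b \<noteq> 0"
    using form_pos[of b] assms by simp
  \<comment> \<open>In the second coordinate, scaling by \<open>cjg b\<close> yields a factor
    \<open>B b b\<close> that cancels \<open>inverse (B b b)\<close>. What remains are these left
    sides with weight \<open>- D\<close>; the right sides come from the first coordinate with weight
    \<open>D\<close>.\<close>
  have cross1: "B (cjg c) (cjg (cjg a \<otimes> cjg (b \<otimes> cjg f))) = B (a \<otimes> c) (cjg (b \<otimes> cjg f))"
    using assms by (simp add: form_adjoint)
  have cross2: "B (cjg (cjg a \<otimes> cjg (b \<otimes> cjg d))) (cjg e) = B (cjg (b \<otimes> cjg d)) (a \<otimes> e)"
    using assms by (simp add: form_adjoint)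
  show ?thesis
    using assms False nz
    by (simp add: cs_mult_nonzero form_scale cross1 cross2 field_simps)
qed

lemma composition_algebra_double: "composition_algebra (cs_double K D) (double_form B D)"
proof
  show "\<zero>\<^bsub>cs_double K D\<^esub> \<in> carrier (cs_double K D)"
    and "\<one>\<^bsub>cs_double K D\<^esub> \<in> carrier (cs_double K D)"
    and "cjg\<^bsub>cs_double K D\<^esub> \<one>\<^bsub>cs_double K D\<^esub> = \<one>\<^bsub>cs_double K D\<^esub>"
    by (simp_all add: a_inv_eq_smult)
next
  fix x s
  assume "x \<in> carrier (cs_double K D)"
  then obtain a b where x: "x = Double a b" "a \<in> carrier K" "b \<in> carrier K"
    by (rule cs_double_carrierE)
  then show "s \<odot>\<^bsub>cs_double K D\<^esub> x \<in> carrier (cs_double K D)"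
    and "cjg\<^bsub>cs_double K D\<^esub> x \<in> carrier (cs_double K D)"
    and "double_form B D \<zero>\<^bsub>cs_double K D\<^esub> x = 0"
    and "cjg\<^bsub>cs_double K D\<^esub> (cjg\<^bsub>cs_double K D\<^esub> x) = x"
    by (simp_all add: a_inv_eq_smult)
  show "x \<otimes>\<^bsub>cs_double K D\<^esub> \<one>\<^bsub>cs_double K D\<^esub> = x"
    using x by (cases "b = \<zero>") (auto simp: cs_mult_zero cs_mult_nonzero)
  assume "x \<noteq> \<zero>\<^bsub>cs_double K D\<^esub>"
  then have "a \<noteq> \<zero> \<or> b \<noteq> \<zero>"
    using x by auto
  \<comment> \<open>The negative sign of \<open>D\<close> makes both summands of
    \<open>B a a - D * B b b\<close> nonnegative.\<close>
  moreover have "0 < B a a \<or> a = \<zero>" "D * B b b < 0 \<or> b = \<zero>"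
    using x D form_pos mult_neg_pos by blast+
  ultimately show "0 < double_form B D x x"
    using x by auto
next
  fix x y s
  assume x: "x \<in> carrier (cs_double K D)" and y: "y \<in> carrier (cs_double K D)"
  obtain a b where ab: "x = Double a b" "a \<in> carrier K" "b \<in> carrier K"
    using x by (rule cs_double_carrierE)
  obtain c d where cd: "y = Double c d" "c \<in> carrier K" "d \<in> carrier K"
    using y by (rule cs_double_carrierE)
  note xy = ab cd
  show "x \<oplus>\<^bsub>cs_double K D\<^esub> y \<in> carrier (cs_double K D)"
    using xy by simp
  show "double_form B D x y = double_form B D y x"
    using xy by (simp add: form_commute[of a c] form_commute[of b d])
  show "double_form B D (s \<odot>\<^bsub>cs_double K D\<^esub> x) y = s * double_form B D x y"
    using xy by (simp add: algebra_simps)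
  show "double_form B D (cjg\<^bsub>cs_double K D\<^esub> x) y = double_form B D x (cjg\<^bsub>cs_double K D\<^esub> y)"
    using xy by (simp add: a_inv_eq_smult form_cjg)
  show "(s \<odot>\<^bsub>cs_double K D\<^esub> x) \<otimes>\<^bsub>cs_double K D\<^esub> y = s \<odot>\<^bsub>cs_double K D\<^esub> (x \<otimes>\<^bsub>cs_double K D\<^esub> y)"
    unfolding ab cd using xy by (intro double_smult_mult)
  show "x \<otimes>\<^bsub>cs_double K D\<^esub> y \<in> carrier (cs_double K D)"
    using xy by (cases "b = \<zero>") (simp_all add: cs_mult_zero cs_mult_nonzero)
  assume eq: "\<And>z. z \<in> carrier (cs_double K D) \<Longrightarrow> double_form B D x z = double_form B D y z"
  have "a = c"
  proof (rule form_ext)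
    fix z
    assume "z \<in> carrier K"
    then show "B a z = B c z"
      using eq[of "Double z \<zero>"] xy by simp
  qed (use xy in auto)
  moreover have "b = d"
  proof (rule form_ext)
    fix z
    assume "z \<in> carrier K"
    then show "B b z = B d z"
      using eq[of "Double \<zero> z"] xy D by simp
  qed (use xy in auto)
  ultimately show "x = y"
    using xy by simp
next
  fix x y z
  assume x: "x \<in> carrier (cs_double K D)" and y: "y \<in> carrier (cs_double K D)"
    and z: "z \<in> carrier (cs_double K D)"
  obtain a b where ab: "x = Double a b" "a \<in> carrier K" "b \<in> carrier K"
    using x by (rule cs_double_carrierE)
  obtain c d where cd: "y = Double c d" "c \<in> carrier K" "d \<in> carrier K"
    using y by (rule cs_double_carrierE)
  obtain e f where ef: "z = Double e f" "e \<in> carrier K" "f \<in> carrier K"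
    using z by (rule cs_double_carrierE)
  show "double_form B D (x \<oplus>\<^bsub>cs_double K D\<^esub> y) z = double_form B D x z + double_form B D y z"
    using ab cd ef by (simp add: algebra_simps)
  show "double_form B D (x \<otimes>\<^bsub>cs_double K D\<^esub> y) z =
      double_form B D y (cjg\<^bsub>cs_double K D\<^esub> x \<otimes>\<^bsub>cs_double K D\<^esub> z)"
    unfolding ab cd ef using ab cd ef by (intro double_form_adjoint)
  show "double_form B D (x \<otimes>\<^bsub>cs_double K D\<^esub> y) (x \<otimes>\<^bsub>cs_double K D\<^esub> z) =
      double_form B D x x * double_form B D y z"
    unfolding ab cd ef using ab cd ef by (intro double_form_scale)
qed

end

section \<open>The base field and the tower\<close>

definition base_form :: "'k::field nested \<Rightarrow> 'k nested \<Rightarrow> 'k"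
  where "base_form x y = (case (x, y) of (Base a, Base b) \<Rightarrow> a * b | _ \<Rightarrow> undefined)"

text \<open>With trivial conjugation the form is the field product itself: adjointness and scaling
  are commutativity and associativity, positivity is that of nonzero squares, and testing against 1
  gives nondegeneracy.\<close>

lemma composition_algebra_base:
  "composition_algebra (base_algebra :: ('k::linordered_field, 'k nested) conj_algebra) base_form"
proof
  fix x y :: "'k nested"
  assume xy: "x \<in> carrier base_algebra" "y \<in> carrier base_algebra"
    and eq: "\<And>z. z \<in> carrier base_algebra \<Longrightarrow> base_form x z = base_form y z"
  have "base_form x (Base 1) = base_form y (Base 1)"
    by (rule eq) (simp add: base_algebra_def)
  with xy show "x = y"
    by (auto simp: base_algebra_def base_form_def)
next
  fix x :: "'k nested"
  assume "x \<in> carrier base_algebra" "x \<noteq> \<zero>\<^bsub>base_algebra\<^esub>"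
  then show "0 < base_form x x"
    by (auto simp: base_algebra_def base_form_def zero_less_mult_iff not_less_iff_gr_or_eq)
qed (auto simp: base_algebra_def base_form_def algebra_simps)

theorem corollary5:
  fixes D :: "nat \<Rightarrow> 'k::linordered_field"
  assumes "\<And>i. D i < 0"
  shows "\<forall>i. multiplicative_norm (cs_tower D i)"
proof
  fix i
  \<comment> \<open>The form changes with \<open>i\<close>, so the induction carries its
    existence.\<close>
  have "\<exists>B. composition_algebra (cs_tower D i) B"
    by (induction i)
      (auto intro: composition_algebra_base composition_algebra_double assms)
  then show "multiplicative_norm (cs_tower D i)"
    using composition_algebra.multiplicative_norm by blast
qed

end
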